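(* Let $m,p\ge 2$ be integers. Then \[\sum_{n=1}^\infty \frac{\zeta(m)\zeta_n(p)-\zeta(p)\zeta_n(m)}{n} = \zeta(p)\sum_{n=1}^\infty \frac{H_n}{n^m} - \zeta(m)\sum_{n=1}^\infty \frac{H_n}{n^p} + \zeta(m)\zeta(p+1) - \zeta(p)\zeta(m+1).\]
   Context: For positive integers $k,n$, $\zeta_n(k)=\sum_{j=1}^n j^{-k}$ and $H_n=\zeta_n(1)=\sum_{j=1}^n \frac1j$. $\zeta(s)=\sum_{n\ge1}n^{-s}$ is the Riemann zeta function. *)

theory Defs
  imports "HOL-Analysis.Analysis"
begin

text \<open>
  The Dirichlet series of the Riemann zeta function at a real argument. It converges only for
  \<open>s > 1\<close>; no analytic continuation is included, so the value is meaningful only there.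
\<close>
definition zeta :: "real \<Rightarrow> real" where
  "zeta s = (\<Sum>n. 1 / real (Suc n) powr s)"

definition zeta_partial :: "nat \<Rightarrow> nat \<Rightarrow> real" where
  "zeta_partial n k = (\<Sum>j=1..n. 1 / real j ^ k)"

lemma zeta_partial_1: "zeta_partial n 1 = harm n"
  by (simp add: zeta_partial_def harm_def divide_inverse)

lemma summable_zeta: "s > 1 \<Longrightarrow> summable (\<lambda>n. 1 / real (Suc n) powr s)"
  using summable_real_powr_iff[of "-s"]
  by (subst (asm) summable_Suc_iff[symmetric]) (simp add: powr_minus divide_inverse)

end

theory Submission
  imports Defs
begin

text \<open>
  The numerator equals \<open>\<zeta>(p) (\<zeta>(m) - \<zeta>\<^sub>n(m)) - \<zeta>(m) (\<zeta>(p) - \<zeta>\<^sub>n(p))\<close>, so it suffices to evaluate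
  the series of \<open>(\<zeta>(k) - \<zeta>\<^sub>n(k)) / n\<close> for a single \<open>k \<ge> 2\<close>. Summation by parts turns its partial sums
  into those of \<open>H\<^sub>n / n\<^sup>k - 1 / n\<^sup>k\<^sup>+\<^sup>1\<close> plus the boundary term \<open>H\<^sub>N (\<zeta>(k) - \<zeta>\<^sub>N(k))\<close>, which is dominated
  by the tail of the convergent series of \<open>H\<^sub>n / n\<^sup>k\<close>.
\<close>

text \<open>The increments compare: 1/(n+1) is at most 2 (sqrt(n+1) - sqrt n). Any power bound with
  exponent below 1 would serve for the convergence at \<open>k = 2\<close>.\<close>

lemma harm_le_2_sqrt: "harm n \<le> 2 * sqrt (real n)"
proof (induction n)
  case 0
  then show ?case by (simp add: harm_def)
next
  case (Suc n)
  define a where "a = sqrt (real n)"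
  define b where "b = sqrt (real (Suc n))"
  have ab: "0 \<le> a" "a \<le> b" "0 < b" "b\<^sup>2 = a\<^sup>2 + 1"
    by (auto simp: a_def b_def)
  have "1 / b\<^sup>2 \<le> 2 * b - 2 * a"
  proof -
    have "1 = (b - a) * (b + a)"
      using ab by (simp add: algebra_simps power2_eq_square)
    \<comment> \<open>As \<open>a \<le> b\<close> and \<open>1 \<le> b\<close>, the sum
      \<open>b + a\<close> is at most 2b, hence at most twice the square of
      \<open>b\<close>.\<close>
    also have "\<dots> \<le> (b - a) * (2 * b\<^sup>2)"
    proof (rule mult_left_mono)
      have "1 \<le> b" by (simp add: b_def)
      hence "b * 1 \<le> b * b" using ab by (intro mult_left_mono) auto
      thus "b + a \<le> 2 * b\<^sup>2" using ab(2) by (simp add: power2_eq_square)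
    qed (use ab in simp)
    finally show ?thesis using ab(3) by (simp add: field_simps)
  qed
  moreover have "b\<^sup>2 = real (Suc n)" by (simp add: b_def)
  ultimately show ?case
    using Suc by (simp add: harm_Suc a_def b_def divide_inverse)
qed

text \<open>The worst case is \<open>k = 2\<close>, where the square root bound on
  \<open>harm\<close> leaves a multiple of the convergent series with exponent 3/2.\<close>

lemma summable_harm_over_power:
  assumes "k \<ge> 2"
  shows "summable (\<lambda>n. harm (Suc n) / real (Suc n) ^ k)"
proof (rule summable_comparison_test')
  show "summable (\<lambda>n. 2 * (1 / real (Suc n) powr (3/2)))"
    by (intro summable_mult summable_zeta) simp
  fix n :: nat
  define x where "x = real (Suc n)"
  have x: "x \<ge> 1" by (simp add: x_def)
  have "harm (Suc n) / x ^ k \<le> (2 * sqrt x) / x ^ 2"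
    using x assms harm_le_2_sqrt[of "Suc n"] harm_nonneg[of "Suc n", where 'a=real]
    by (intro frac_le power_increasing) (auto simp: x_def)
  also have "\<dots> = 2 * (1 / x powr (3/2))"
  proof -
    have "x ^ 2 = x powr (1/2) * x powr (3/2)"
      using x by (simp flip: powr_add powr_numeral)
    thus ?thesis using x by (simp add: powr_half_sqrt)
  qed
  finally show "norm (harm (Suc n) / real (Suc n) ^ k) \<le> 2 * (1 / real (Suc n) powr (3/2))"
    by (simp add: x_def harm_nonneg)
qed

lemma inverse_power_sums_zeta:
  assumes "k \<ge> 2"
  shows "(\<lambda>n. 1 / real (Suc n) ^ k) sums zeta (real k)"
proof -
  have "(\<lambda>n. 1 / real (Suc n) powr real k) sums zeta (real k)"
    unfolding zeta_def using assms by (intro summable_sums summable_zeta) simp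
  thus ?thesis by (simp add: powr_realpow del: of_nat_Suc)
qed

lemma zeta_partial_eq_sum_lessThan: "zeta_partial n k = (\<Sum>j<n. 1 / real (Suc j) ^ k)"
  unfolding zeta_partial_def
  \<comment> \<open>The shift needs a successor as upper bound, hence \<open>n - 1\<close>; for
    \<open>n = 0\<close> both sums are empty.\<close>
  using sum.shift_bounds_cl_Suc_ivl[of "\<lambda>j. 1 / real j ^ k" 0 "n - 1"]
  by (cases n) (auto simp: lessThan_Suc_atMost atLeast0AtMost)

lemma zeta_partial_Suc: "zeta_partial (Suc n) k = zeta_partial n k + 1 / real (Suc n) ^ k"
  by (simp add: zeta_partial_eq_sum_lessThan)

text \<open>Abel summation with 1/n = H_n - H_{n-1}: the differences of the other factor contribute
  H_{n-1}/n^k, which is H_n/n^k - 1/n^(k+1). The identity is purely algebraic, so \<open>Z\<close>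
  is arbitrary.\<close>

lemma sum_diff_zeta_partial_by_parts:
  "(\<Sum>n<N. (Z - zeta_partial (Suc n) k) / real (Suc n)) =
     harm N * (Z - zeta_partial N k)
     + (\<Sum>n<N. harm (Suc n) / real (Suc n) ^ k) - (\<Sum>n<N. 1 / real (Suc n) ^ (k + 1))"
proof (induction N)
  case 0
  then show ?case by (simp add: harm_def)
next
  case (Suc N)
  \<comment> \<open>In terms of \<open>x\<close> and \<open>x ^ k\<close> the induction step is a
    polynomial identity.\<close>
  define x where "x = inverse (real (Suc N))"
  have *: "harm (Suc N) = harm N + x" "1 / real (Suc N) ^ k = x ^ k"
    "1 / real (Suc N) ^ (k + 1) = x * x ^ k"
    by (simp_all add: harm_Suc x_def field_simps)
  have y: "y / real (Suc N) = y * x" "y / real (Suc N) ^ k = y * x ^ k" for y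
    by (simp_all add: x_def divide_inverse flip: power_inverse)
  show ?case
    unfolding sum.lessThan_Suc Suc.IH
    unfolding zeta_partial_Suc * y by (simp add: algebra_simps)
qed

lemma harm_times_zeta_tail_tendsto_0:
  assumes "k \<ge> 2"
  shows "(\<lambda>N. harm N * (zeta (real k) - zeta_partial N k)) \<longlonglongrightarrow> 0"
proof (rule tendsto_sandwich)
  let ?a = "\<lambda>n. 1 / real (Suc n) ^ k" and ?h = "\<lambda>n. harm (Suc n) / real (Suc n) ^ k"
  have h: "summable ?h"
    by (rule summable_harm_over_power[OF assms])
  have tail: "(\<lambda>n. ?a (n + N)) sums (zeta (real k) - zeta_partial N k)" for N
    unfolding zeta_partial_eq_sum_lessThan
    by (rule sums_split_initial_segment[OF inverse_power_sums_zeta[OF assms]])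
  have tail_h: "(\<lambda>n. ?h (n + N)) sums (suminf ?h - sum ?h {..<N})" for N
    by (rule sums_split_initial_segment[OF summable_sums[OF h]])
  have "0 \<le> zeta (real k) - zeta_partial N k" for N
    by (rule sums_le[OF _ sums_zero tail]) simp
  thus "\<forall>\<^sub>F N in sequentially. 0 \<le> harm N * (zeta (real k) - zeta_partial N k)"
    by (simp add: harm_nonneg)
  \<comment> \<open>Harmonic numbers increase, so the factor \<open>harm N\<close> can be moved into
    the tail and replaced termwise by the larger \<open>harm (Suc (n + N))\<close>.\<close>
  have "harm N * (zeta (real k) - zeta_partial N k) \<le> suminf ?h - sum ?h {..<N}" for N
  proof (rule sums_le[OF _ sums_mult[OF tail] tail_h])
    fix n
    have "harm N \<le> (harm (Suc (n + N)) :: real)" by (intro harm_mono) simp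
    thus "harm N * ?a (n + N) \<le> ?h (n + N)" by (simp add: divide_right_mono)
  qed
  thus "\<forall>\<^sub>F N in sequentially.
      harm N * (zeta (real k) - zeta_partial N k) \<le> suminf ?h - sum ?h {..<N}"
    by simp
  show "(\<lambda>N. suminf ?h - sum ?h {..<N}) \<longlonglongrightarrow> 0"
    using tendsto_diff[OF tendsto_const[of "suminf ?h"] summable_LIMSEQ[OF h]] by simp
qed simp

lemma zeta_tail_over_n_sums:
  assumes "k \<ge> 2"
  shows "(\<lambda>n. (zeta (real k) - zeta_partial (Suc n) k) / real (Suc n)) sums
    ((\<Sum>n. harm (Suc n) / real (Suc n) ^ k) - zeta (real (k + 1)))"
proof -
  have "(\<lambda>N. \<Sum>n<N. 1 / real (Suc n) ^ (k + 1)) \<longlonglongrightarrow> zeta (real (k + 1))"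
    using inverse_power_sums_zeta[of "k + 1"] assms unfolding sums_def by simp
  from tendsto_diff[OF tendsto_add[OF harm_times_zeta_tail_tendsto_0[OF assms]
      summable_LIMSEQ[OF summable_harm_over_power[OF assms]]] this]
  show ?thesis
    unfolding sums_def sum_diff_zeta_partial_by_parts by simp
qed

theorem theorem2p1:
  fixes m p :: nat
  assumes "m \<ge> 2" and "p \<ge> 2"
  shows "summable (\<lambda>n. harm (Suc n) / real (Suc n) ^ m)
    \<and> summable (\<lambda>n. harm (Suc n) / real (Suc n) ^ p)
    \<and> (\<lambda>n. (zeta (real m) * zeta_partial (Suc n) p - zeta (real p) * zeta_partial (Suc n) m)
            / real (Suc n))
      sums (zeta (real p) * (\<Sum>n. harm (Suc n) / real (Suc n) ^ m)
          - zeta (real m) * (\<Sum>n. harm (Suc n) / real (Suc n) ^ p)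
          + zeta (real m) * zeta (real (p + 1)) - zeta (real p) * zeta (real (m + 1)))"
proof (intro conjI)
  show "(\<lambda>n. (zeta (real m) * zeta_partial (Suc n) p - zeta (real p) * zeta_partial (Suc n) m)
            / real (Suc n))
      sums (zeta (real p) * (\<Sum>n. harm (Suc n) / real (Suc n) ^ m)
          - zeta (real m) * (\<Sum>n. harm (Suc n) / real (Suc n) ^ p)
          + zeta (real m) * zeta (real (p + 1)) - zeta (real p) * zeta (real (m + 1)))"
    \<comment> \<open>In the difference of the two scaled series the constant
      \<open>zeta (real p) * zeta (real m)\<close> cancels from the numerators.\<close>
    using sums_diff[OF sums_mult[OF zeta_tail_over_n_sums[OF assms(1)], of "zeta (real p)"]
        sums_mult[OF zeta_tail_over_n_sums[OF assms(2)], of "zeta (real m)"]]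
    by (simp add: diff_divide_distrib algebra_simps)
qed (use assms summable_harm_over_power in auto)

end
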